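(* There is a constant $c\in\mathbb{N}$ such that there are infinitely many $n\in\mathbb{N}$ satisfying \[ \mathrm{DN}(\mathrm{FO}[n])\ge \mathrm{twr}\bigl(\sqrt[5]{n/c}\bigr). \]
   Context: Words are nonempty finite words over $\Sigma=\{l,r\}$, identified with word models (positions with linear order $<$ and unary predicates $P_l,P_r$). FO formulas are over $\{<,P_l,P_r\}$. Size: $\mathrm{sz}(\phi)=1$ for atomic $\phi$; $\mathrm{sz}(\psi\wedge\theta)=\mathrm{sz}(\psi\vee\theta)=\mathrm{sz}(\psi)+\mathrm{sz}(\theta)+1$; $\mathrm{sz}(\neg\psi)=\mathrm{sz}(\exists x\psi)=\mathrm{sz}(\forall x\psi)=\mathrm{sz}(\psi)+1$. $\mathrm{FO}[n]$ is the set of FO formulas of size at most $n$. A sentence $\phi$ defines a word $w$ if $w$ is the only word satisfying $\phi$; $\mathrm{Def}(L)$ is the set of words defined by some sentence of $L$, and $\mathrm{DN}(L)=\max\{|w|: w\in\mathrm{Def}(L)\}$ (the length of the longest $L$-definable word). $\mathrm{tower}(0)=1$, $\mathrm{tower}(n+1)=2^{\mathrm{tower}(n)}$; for real $x\ge0$, $\mathrm{twr}(x)=\mathrm{tower}(\lceil x\rceil)$. *)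

theory Defs
  imports Complex_Main
begin

datatype letter = Let_l | Let_r

text \<open>
  Words are nonempty lists; a word \<open>w\<close> is identified with the word model whose domain is the
  set of positions \<open>{..<length w}\<close>, ordered as natural numbers, where \<open>Pred a\<close> holds at the
  positions carrying the letter \<open>a\<close>.
\<close>

definition Words :: "letter list set" where
  "Words = {w. w \<noteq> []}"

text \<open>Variables are named by natural numbers. Equality is a logical symbol, hence atomic.\<close>

datatype fo =
    Eq nat nat
  | Less nat nat
  | Pred letter nat
  | Neg fo
  | Conj fo fo
  | Disj fo fo
  | Ex nat fo
  | All nat fo

primrec sz :: "fo \<Rightarrow> nat" where
  "sz (Eq x y) = 1"
| "sz (Less x y) = 1"
| "sz (Pred a x) = 1"
| "sz (Neg \<phi>) = sz \<phi> + 1"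
| "sz (Conj \<phi> \<psi>) = sz \<phi> + sz \<psi> + 1"
| "sz (Disj \<phi> \<psi>) = sz \<phi> + sz \<psi> + 1"
| "sz (Ex x \<phi>) = sz \<phi> + 1"
| "sz (All x \<phi>) = sz \<phi> + 1"

primrec fv :: "fo \<Rightarrow> nat set" where
  "fv (Eq x y) = {x, y}"
| "fv (Less x y) = {x, y}"
| "fv (Pred a x) = {x}"
| "fv (Neg \<phi>) = fv \<phi>"
| "fv (Conj \<phi> \<psi>) = fv \<phi> \<union> fv \<psi>"
| "fv (Disj \<phi> \<psi>) = fv \<phi> \<union> fv \<psi>"
| "fv (Ex x \<phi>) = fv \<phi> - {x}"
| "fv (All x \<phi>) = fv \<phi> - {x}"

definition sentence :: "fo \<Rightarrow> bool" where
  "sentence \<phi> \<longleftrightarrow> fv \<phi> = {}"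

primrec sat :: "letter list \<Rightarrow> (nat \<Rightarrow> nat) \<Rightarrow> fo \<Rightarrow> bool" where
  "sat w s (Eq x y) \<longleftrightarrow> s x = s y"
| "sat w s (Less x y) \<longleftrightarrow> s x < s y"
| "sat w s (Pred a x) \<longleftrightarrow> w ! s x = a"
| "sat w s (Neg \<phi>) \<longleftrightarrow> \<not> sat w s \<phi>"
| "sat w s (Conj \<phi> \<psi>) \<longleftrightarrow> sat w s \<phi> \<and> sat w s \<psi>"
| "sat w s (Disj \<phi> \<psi>) \<longleftrightarrow> sat w s \<phi> \<or> sat w s \<psi>"
| "sat w s (Ex x \<phi>) \<longleftrightarrow> (\<exists>i<length w. sat w (s(x := i)) \<phi>)"
| "sat w s (All x \<phi>) \<longleftrightarrow> (\<forall>i<length w. sat w (s(x := i)) \<phi>)"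

text \<open>For sentences the choice of the assignment is immaterial; position 0 exists in every word.\<close>

definition models :: "letter list \<Rightarrow> fo \<Rightarrow> bool" where
  "models w \<phi> \<longleftrightarrow> sat w (\<lambda>_. 0) \<phi>"

definition defines_word :: "fo \<Rightarrow> letter list \<Rightarrow> bool" where
  "defines_word \<phi> w \<longleftrightarrow> w \<in> Words \<and> models w \<phi> \<and> (\<forall>u\<in>Words. models u \<phi> \<longrightarrow> u = w)"

definition FO :: "nat \<Rightarrow> fo set" where
  "FO n = {\<phi>. sz \<phi> \<le> n}"

definition Def :: "fo set \<Rightarrow> letter list set" where
  "Def L = {w. \<exists>\<phi>\<in>L. sentence \<phi> \<and> defines_word \<phi> w}"

text \<open>
  \<open>Def (FO n)\<close> is finite, as there are only finitely many sentences of size at most \<open>n\<close> up to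
  renaming of variables. It is empty only for finitely many \<open>n\<close>; for those \<open>DN\<close> is unspecified.
\<close>

definition DN :: "fo set \<Rightarrow> nat" where
  "DN L = Max (length ` Def L)"

primrec tower :: "nat \<Rightarrow> nat" where
  "tower 0 = 1"
| "tower (Suc n) = 2 ^ tower n"

text \<open>Intended for \<open>x \<ge> 0\<close>.\<close>

definition twr :: "real \<Rightarrow> nat" where
  "twr x = tower (nat \<lceil>x\<rceil>)"

end

theory Submission
  imports Defs
begin

text \<open>
  The defining sentence describes a deterministic process that produces a word from left to right:
  every letter is prescribed by a formula about the preceding letters, and a formula about the
  prefix tells whether the word ends. Such a sentence has at most one model. The process is a
  binary counter iterated \<open>k\<close> times, the bits of a counter of level \<open>j + 1\<close> being indexed by the
  values of the counter of level \<open>j\<close>; a bit flips with respect to the previous number exactly if all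
  lower bits of the previous number are 1. Corresponding bits are found by comparing their indices
  recursively, so the sentence has size \<open>O(k\<^sup>3)\<close>, while the counter stops only after \<open>tower k\<close> steps.
\<close>

section \<open>Iterated binary counters\<close>

text \<open>Determinism splits the correctness proof into two independent halves. For existence, one
  explicit word is checked, so the formulas need a known meaning only on well-formed words.
  Uniqueness uses no meaning at all: quantifiers in the rules are bounded by the current position,
  so two models cannot have a first difference, and no axiom about the shape of the word is needed.
  The explicit word is again a number. A number of level \<open>k + 1\<close> lists all numbers of
  level \<open>k\<close> as indices, so a complete run of the level \<open>k\<close> counter is the
  number 0 of level \<open>k + 1\<close>. The cubic size arises as follows: codes are spelled in
  unary, so testing one costs linear size; comparison adds one linear piece per level and is
  quadratic; one update rule per level gives the cube. The fifth root in the theorem therefore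
  leaves room.\<close>

primrec num_len :: "nat \<Rightarrow> nat" where
  "num_len 0 = 0"
| "num_len (Suc j) = tower j * Suc (num_len j)"

text \<open>
  A number below \<open>tower (Suc j)\<close> is written by listing all numbers \<open>i\<close> below \<open>tower j\<close> in order,
  each followed by a digit of level \<open>j\<close> carrying the \<open>i\<close>-th bit; the digit with bit \<open>b\<close> has code
  \<open>2 * j + b\<close>. Since every index occurs, all numbers of one level have the same length.
\<close>

primrec num_code :: "nat \<Rightarrow> nat \<Rightarrow> nat \<Rightarrow> nat" where
  "num_code 0 a p = 0"
| "num_code (Suc j) a p =
    (if p mod Suc (num_len j) = num_len j
     then 2 * j + of_bool (bit a (p div Suc (num_len j)))
     else num_code j (p div Suc (num_len j)) (p mod Suc (num_len j)))"

definition digit_pos :: "nat \<Rightarrow> nat \<Rightarrow> nat" where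
  "digit_pos j i = i * Suc (num_len j) + num_len j"

text \<open>The left neighbour has a code larger than all codes inside the number, so a backward
  search over small codes stops at the boundary. The case \<open>t = 0\<close> is separate because
  \<open>t - 1\<close> would be truncated.\<close>

definition starts :: "(nat \<Rightarrow> nat) \<Rightarrow> nat \<Rightarrow> nat \<Rightarrow> nat \<Rightarrow> bool" where
  "starts c j a t \<longleftrightarrow>
     (\<forall>p<num_len j. c (t + p) = num_code j a p) \<and> (t = 0 \<or> 2 * j \<le> c (t - 1))"

definition ends :: "(nat \<Rightarrow> nat) \<Rightarrow> nat \<Rightarrow> nat \<Rightarrow> nat \<Rightarrow> bool" where
  "ends c j a t \<longleftrightarrow> (\<exists>t0. t = t0 + num_len j \<and> starts c j a t0)"

text \<open>If a number of level \<open>j + 1\<close> ends just before \<open>t\<close>, these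
  \<open>u\<close> are exactly its digits: a higher code in between would mean that its left
  boundary has been crossed.\<close>

definition digit_before :: "(nat \<Rightarrow> nat) \<Rightarrow> nat \<Rightarrow> nat \<Rightarrow> nat \<Rightarrow> bool" where
  "digit_before c j u t \<longleftrightarrow> u < t \<and> 2 * j \<le> c u \<and> (\<forall>z. u \<le> z \<and> z < t \<longrightarrow> c z < 2 * j + 2)"

primrec same_num :: "(nat \<Rightarrow> nat) \<Rightarrow> nat \<Rightarrow> nat \<Rightarrow> nat \<Rightarrow> bool" where
  "same_num c 0 t t' \<longleftrightarrow> True"
| "same_num c (Suc j) t t' \<longleftrightarrow> (\<forall>u. digit_before c j u t \<longrightarrow>
     (\<exists>v. digit_before c j v t' \<and> same_num c j u v \<and> (2 * j + 1 \<le> c u \<longleftrightarrow> 2 * j + 1 \<le> c v)))"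

primrec all_ones :: "(nat \<Rightarrow> nat) \<Rightarrow> nat \<Rightarrow> nat \<Rightarrow> bool" where
  "all_ones c 0 t \<longleftrightarrow> True"
| "all_ones c (Suc j) t \<longleftrightarrow> (\<forall>u. digit_before c j u t \<longrightarrow> 2 * j + 1 \<le> c u)"

text \<open>A digit of level \<open>j\<close> with an all-ones, hence maximal, index completes a
  number of level \<open>j + 1\<close>, so a digit of level \<open>j + 1\<close> is due at
  \<open>t\<close>.\<close>

definition level_done :: "(nat \<Rightarrow> nat) \<Rightarrow> nat \<Rightarrow> nat \<Rightarrow> bool" where
  "level_done c j t \<longleftrightarrow> 0 < t \<and> 2 * j \<le> c (t - 1) \<and> c (t - 1) < 2 * j + 2 \<and> all_ones c j (t - 1)"

text \<open>Here \<open>s\<close> is the digit closing the previous number of level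
  \<open>j + 1\<close> in the same list, and \<open>p\<close> is its bit with the index just written
  before \<open>t\<close>. The bit keeps its value iff some lower bit is 0, which stops the carry.
  Without such an \<open>s\<close> the number is the first of its list, and the bit is 0.\<close>

definition next_bit :: "(nat \<Rightarrow> nat) \<Rightarrow> nat \<Rightarrow> nat \<Rightarrow> bool" where
  "next_bit c j t \<longleftrightarrow> (\<exists>s<t. 2 * j + 2 \<le> c s \<and> c s < 2 * j + 4 \<and>
     (\<forall>z. s < z \<and> z < t \<longrightarrow> c z < 2 * j + 2) \<and>
     (\<exists>p. digit_before c j p s \<and> same_num c j p t \<and>
       (2 * j + 1 \<le> c p \<longleftrightarrow> (\<exists>u<p. digit_before c j u s \<and> c u < 2 * j + 1))))"

section \<open>Binary increment and equality of numbers by bits\<close>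

lemma tower_pos: "0 < tower j"
  by (cases j) auto

text \<open>By halving: the successor of an even number changes only bit 0, while the successor of
  an odd number clears bit 0 and carries into \<open>a div 2\<close>.\<close>

lemma bit_Suc_nat:
  fixes a :: nat
  shows "bit (Suc a) i \<longleftrightarrow> (bit a i \<longleftrightarrow> (\<exists>i'<i. \<not> bit a i'))"
proof (induction i arbitrary: a)
  case 0
  show ?case by (simp add: bit_0)
next
  case (Suc i)
  have split: "(\<exists>i'<Suc i. \<not> bit a i') \<longleftrightarrow> even a \<or> (\<exists>i'<i. \<not> bit (a div 2) i')"
    by (auto simp: bit_Suc bit_0 less_Suc_eq_0_disj)
  show ?case
  proof (cases "even a")
    case True
    then have "Suc a div 2 = a div 2" by simp
    with True split show ?thesis by (simp add: bit_Suc)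
  next
    case False
    then have "Suc a div 2 = Suc (a div 2)" by simp
    with False split Suc show ?thesis by (simp add: bit_Suc)
  qed
qed

lemma not_bit_if_less:
  fixes a :: nat
  assumes "a < 2 ^ n" "n \<le> i"
  shows "\<not> bit a i"
proof -
  have "a < 2 ^ i" using assms by (meson less_le_trans one_le_numeral power_increasing)
  then show ?thesis by (simp add: bit_iff_odd)
qed

lemma nat_eqI_bits:
  fixes a b :: nat
  assumes "a < 2 ^ n" "b < 2 ^ n" "\<And>i. i < n \<Longrightarrow> bit a i = bit b i"
  shows "a = b"
proof (rule bit_eqI)
  fix i
  show "bit a i \<longleftrightarrow> bit b i"
    using assms not_bit_if_less by (cases "i < n") auto
qed

lemma all_bits_iff:
  fixes a :: nat
  assumes "a < 2 ^ n"
  shows "(\<forall>i<n. bit a i) \<longleftrightarrow> Suc a = 2 ^ n"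
proof -
  have *: "bit (2 ^ n - 1 :: nat) i" if "i < n" for i
    using that by (simp add: bit_mask_iff possible_bit_def flip: mask_eq_exp_minus_1 del: One_nat_def)
  have "(\<forall>i<n. bit a i) \<longleftrightarrow> a = 2 ^ n - 1"
    using nat_eqI_bits[OF assms, of "2 ^ n - 1"] * by auto
  also have "\<dots> \<longleftrightarrow> Suc a = 2 ^ n" using assms by auto
  finally show ?thesis .
qed

section \<open>Layout of a number and recognition of its digits\<close>

lemma num_code_less: "p < num_len j \<Longrightarrow> num_code j a p < 2 * j"
proof (induction j arbitrary: a p)
  case (Suc j)
  show ?case
  proof (cases "p mod Suc (num_len j) = num_len j")
    case False
    moreover have "p mod Suc (num_len j) < Suc (num_len j)" by simp
    ultimately have "p mod Suc (num_len j) < num_len j" by linarith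
    from Suc.IH[OF this] False show ?thesis by (simp add: less_SucI)
  qed simp
qed simp

lemma digit_pos_less: "i < tower j \<Longrightarrow> digit_pos j i < num_len (Suc j)"
proof -
  assume "i < tower j"
  then have "Suc i * Suc (num_len j) \<le> tower j * Suc (num_len j)"
    by (intro mult_le_mono1) simp
  then show ?thesis by (simp add: digit_pos_def)
qed

lemma num_code_digit: "num_code (Suc j) a (digit_pos j i) = 2 * j + of_bool (bit a i)"
proof -
  have "digit_pos j i mod Suc (num_len j) = num_len j" "digit_pos j i div Suc (num_len j) = i"
    unfolding digit_pos_def by (simp_all del: mult_Suc_right)
  then show ?thesis by simp
qed

lemma num_code_inner:
  "q < num_len j \<Longrightarrow> num_code (Suc j) a (i * Suc (num_len j) + q) = num_code j i q"
proof -
  assume "q < num_len j"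
  moreover from this have "(i * Suc (num_len j) + q) mod Suc (num_len j) = q"
    "(i * Suc (num_len j) + q) div Suc (num_len j) = i"
    by (simp_all del: mult_Suc_right)
  ultimately show ?thesis by simp
qed

lemma num_pos_cases:
  assumes "p < num_len (Suc j)"
  obtains i where "i < tower j" "p = digit_pos j i"
  | i q where "i < tower j" "q < num_len j" "p = i * Suc (num_len j) + q"
proof -
  define i q where "i = p div Suc (num_len j)" and "q = p mod Suc (num_len j)"
  have p: "p = i * Suc (num_len j) + q" unfolding i_def q_def by (simp only: div_mult_mod_eq)
  have "i < tower j" using assms unfolding i_def by (simp add: less_mult_imp_div_less)
  moreover have "q < Suc (num_len j)" unfolding q_def by simp
  moreover have "p = digit_pos j i" if "q = num_len j" using p that by (simp add: digit_pos_def)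
  ultimately show thesis
    using that p by (cases "q = num_len j") (blast, metis less_SucE)
qed

lemma starts_code:
  "starts c j a t \<Longrightarrow> p < num_len j \<Longrightarrow> c (t + p) = num_code j a p"
  by (simp add: starts_def)

lemma starts_digit:
  assumes "starts c (Suc j) a t" "i < tower j"
  shows "c (t + digit_pos j i) = 2 * j + of_bool (bit a i)"
  using starts_code[OF assms(1) digit_pos_less[OF assms(2)]] num_code_digit by simp

text \<open>The boundary of an index is the preceding digit of the enclosing number, or for
  \<open>i = 0\<close> the boundary of that number itself.\<close>

lemma starts_sub:
  assumes "starts c (Suc j) a t" "i < tower j"
  shows "starts c j i (t + i * Suc (num_len j))"
  unfolding starts_def
proof (intro conjI allI impI)
  fix q assume q: "q < num_len j"
  then have "i * Suc (num_len j) + q < num_len (Suc j)"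
    using digit_pos_less[OF assms(2)] by (simp add: digit_pos_def)
  from starts_code[OF assms(1) this] num_code_inner[OF q]
  show "c (t + i * Suc (num_len j) + q) = num_code j i q" by (simp only: add.assoc)
next
  show "t + i * Suc (num_len j) = 0 \<or> 2 * j \<le> c (t + i * Suc (num_len j) - 1)"
  proof (cases i)
    case 0
    with assms(1) show ?thesis by (auto simp: starts_def)
  next
    case (Suc i')
    then have "t + i * Suc (num_len j) - 1 = t + digit_pos j i'"
      by (simp add: digit_pos_def)
    with starts_digit[OF assms(1), of i'] Suc assms(2) show ?thesis by simp
  qed
qed

lemma ends_digit:
  assumes "starts c (Suc j) a t" "i < tower j"
  shows "ends c j i (t + digit_pos j i)"
  using starts_sub[OF assms] by (auto simp: ends_def digit_pos_def)

text \<open>The search cannot pass \<open>t\<close>, since the code before it is at least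
  \<open>2 * j + 2\<close>; inside the number only the digit positions have codes reaching
  \<open>2 * j\<close>.\<close>

lemma digit_before_iff:
  assumes "starts c (Suc j) a t"
  shows "digit_before c j u (t + num_len (Suc j)) \<longleftrightarrow> (\<exists>i<tower j. u = t + digit_pos j i)"
proof
  assume u: "digit_before c j u (t + num_len (Suc j))"
  have "t \<le> u"
  proof (rule ccontr)
    assume "\<not> t \<le> u"
    then have "u \<le> t - 1" "t - 1 < t + num_len (Suc j)" "0 < t" by simp_all
    with u have "c (t - 1) < 2 * j + 2" unfolding digit_before_def by blast
    with assms \<open>0 < t\<close> show False by (simp add: starts_def)
  qed
  then obtain p where p: "u = t + p" using le_Suc_ex by blast
  with u have pl: "p < num_len (Suc j)" by (simp add: digit_before_def)
  have ge: "2 * j \<le> num_code (Suc j) a p"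
    using u starts_code[OF assms pl] p by (simp add: digit_before_def)
  from pl show "\<exists>i<tower j. u = t + digit_pos j i"
  proof (cases rule: num_pos_cases)
    case (1 i)
    with p show ?thesis by blast
  next
    case (2 i q)
    then have "num_code (Suc j) a p < 2 * j"
      using num_code_inner[of q j a i] num_code_less[of q j i] by simp
    with ge show ?thesis by simp
  qed
next
  assume "\<exists>i<tower j. u = t + digit_pos j i"
  then obtain i where i: "i < tower j" "u = t + digit_pos j i" by blast
  have "c z < 2 * j + 2" if "u \<le> z" "z < t + num_len (Suc j)" for z
  proof -
    have z: "z = t + (z - t)" "z - t < num_len (Suc j)" using that i by simp_all
    from starts_code[OF assms z(2)] num_code_less[OF z(2), of a] z(1) show ?thesis
      by (metis add_2_eq_Suc' mult_Suc_right add.commute)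
  qed
  then show "digit_before c j u (t + num_len (Suc j))"
    using i starts_digit[OF assms i(1)] digit_pos_less[OF i(1)]
    by (simp add: digit_before_def del: num_len.simps)
qed

lemma all_range_less: "(\<forall>u. (\<exists>i<n. u = f i) \<longrightarrow> P u) \<longleftrightarrow> (\<forall>i<n::nat. P (f i))"
  by blast

text \<open>By induction, two digits have matching indices only if they sit at the same index, so
  the inclusion compares the two numbers bit by bit.\<close>

lemma same_num_iff:
  assumes "ends c j a t" "ends c j b t'" "a < tower j" "b < tower j"
  shows "same_num c j t t' \<longleftrightarrow> a = b"
  using assms
proof (induction j arbitrary: a b t t')
  case 0
  then show ?case by simp
next
  case (Suc j)
  obtain t0 where t: "t = t0 + num_len (Suc j)" "starts c (Suc j) a t0"
    using Suc.prems by (auto simp: ends_def)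
  obtain t0' where t': "t' = t0' + num_len (Suc j)" "starts c (Suc j) b t0'"
    using Suc.prems by (auto simp: ends_def)
  have same: "same_num c j (t0 + digit_pos j i) (t0' + digit_pos j i') \<longleftrightarrow> i = i'"
    if "i < tower j" "i' < tower j" for i i'
    using Suc.IH[OF ends_digit ends_digit] t t' that by blast
  have "same_num c (Suc j) t t' \<longleftrightarrow> (\<forall>i<tower j. bit a i = bit b i)"
    using same starts_digit[OF t(2)] starts_digit[OF t'(2)]
    by (auto simp: t(1) t'(1) digit_before_iff[OF t(2)] digit_before_iff[OF t'(2)] all_range_less
        simp del: num_len.simps)
  also have "\<dots> \<longleftrightarrow> a = b"
    using Suc.prems nat_eqI_bits[of a "tower j" b] by auto
  finally show ?case .
qed

lemma all_ones_iff:
  assumes "ends c j a t" "a < tower j"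
  shows "all_ones c j t \<longleftrightarrow> Suc a = tower j"
proof (cases j)
  case 0
  with assms show ?thesis by simp
next
  case (Suc i)
  obtain t0 where t: "t = t0 + num_len (Suc i)" "starts c (Suc i) a t0"
    using assms Suc by (auto simp: ends_def)
  have "all_ones c j t \<longleftrightarrow> (\<forall>m<tower i. bit a m)"
    using starts_digit[OF t(2)]
    by (auto simp: t(1) Suc digit_before_iff[OF t(2)] all_range_less simp del: num_len.simps)
  also have "\<dots> \<longleftrightarrow> Suc a = tower j"
    using all_bits_iff[of a "tower i"] assms Suc by simp
  finally show ?thesis .
qed

text \<open>
  The context of a number determines what precedes it: nothing, or a digit whose index is not
  maximal. That digit has the same level exactly if the number is not the first one in its list.
\<close>

definition in_context :: "(nat \<Rightarrow> nat) \<Rightarrow> nat \<Rightarrow> nat \<Rightarrow> nat \<Rightarrow> bool" where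
  "in_context c j a t \<longleftrightarrow> starts c j a t \<and> a < tower j \<and>
     (t = 0 \<and> a = 0 \<or>
      0 < t \<and> (\<exists>j' a'. j \<le> j' \<and> c (t - 1) div 2 = j' \<and> ends c j' a' (t - 1) \<and> Suc a' < tower j' \<and>
        a = (if j' = j then Suc a' else 0)))"

text \<open>The code at \<open>t\<close> is the one forced by the past: its level by
  \<open>level_done\<close>, its parity by \<open>next_bit\<close>. Level 0 is the default when no
  level has just been completed.\<close>

definition code_ok :: "(nat \<Rightarrow> nat) \<Rightarrow> nat \<Rightarrow> bool" where
  "code_ok c t \<longleftrightarrow> (\<forall>j. level_done c j t \<longleftrightarrow> c t div 2 = Suc j) \<and>
     (next_bit c (c t div 2) t \<longleftrightarrow> odd (c t))"

lemma in_context_sub: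
  assumes ctx: "in_context c (Suc j) a t" and i: "i < tower j"
  shows "in_context c j i (t + i * Suc (num_len j))"
proof -
  from ctx have st: "starts c (Suc j) a t" by (simp add: in_context_def)
  show ?thesis
  proof (cases i)
    case 0
    with ctx starts_sub[OF st i] i show ?thesis
      unfolding in_context_def by (auto simp: Suc_le_eq)
  next
    case (Suc i')
    have eq: "t + i * Suc (num_len j) - 1 = t + digit_pos j i'"
      using Suc by (simp add: digit_pos_def)
    have i': "i' < tower j" using Suc i by simp
    have "c (t + digit_pos j i') div 2 = j" using starts_digit[OF st i'] by simp
    moreover have "ends c j i' (t + digit_pos j i')" by (rule ends_digit[OF st i'])
    ultimately show ?thesis
      unfolding in_context_def eq using starts_sub[OF st i] i Suc by auto
  qed
qed

text \<open>For \<open>j = 0\<close> the number is empty, and the preceding entry, if any, is the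
  context digit, whose index is not maximal. Otherwise the preceding entry is the last digit of the
  number, whose index is maximal.\<close>

lemma level_done_digit:
  assumes ctx: "in_context c j i t"
  shows "level_done c j' (t + num_len j) \<longleftrightarrow> j = Suc j'"
proof (cases j)
  case 0
  show ?thesis
  proof (cases "t = 0")
    case True
    with 0 show ?thesis by (simp add: level_done_def)
  next
    case False
    with ctx obtain j1 a' where *: "c (t - 1) div 2 = j1" "ends c j1 a' (t - 1)" "Suc a' < tower j1"
      unfolding in_context_def by auto
    have "\<not> all_ones c j1 (t - 1)" using all_ones_iff[OF *(2)] *(3) by simp
    moreover have "j1 = j'" if "2 * j' \<le> c (t - 1)" "c (t - 1) < 2 * j' + 2"
      using that *(1) by auto
    ultimately show ?thesis using 0 by (auto simp: level_done_def)
  qed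
next
  case (Suc m)
  have st: "starts c (Suc m) i t" using ctx Suc by (simp add: in_context_def)
  obtain d where d: "tower m = Suc d" using tower_pos[of m] by (cases "tower m") auto
  have eq: "t + num_len j - 1 = t + digit_pos m d"
    using d Suc by (simp add: digit_pos_def)
  have pos: "0 < t + num_len j" using d Suc by simp
  have "all_ones c m (t + digit_pos m d)"
    using all_ones_iff[OF ends_digit[OF st], of d] d by simp
  moreover have "c (t + digit_pos m d) = 2 * m + of_bool (bit i d)"
    using starts_digit[OF st, of d] d by simp
  moreover have "j' = m" if "2 * j' \<le> 2 * m + of_bool (bit i d)" "2 * m + of_bool (bit i d) < 2 * j' + 2"
    using that by (cases "bit i d") auto
  ultimately show ?thesis using Suc pos unfolding level_done_def eq by auto
qed

lemma next_bit_digit: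
  assumes ctx: "in_context c (Suc j) a t" and i: "i < tower j"
  shows "next_bit c j (t + digit_pos j i) \<longleftrightarrow> bit a i"
proof -
  let ?t = "t + digit_pos j i"
  from ctx have st: "starts c (Suc j) a t" by (simp add: in_context_def)
  have small: "c z < 2 * j + 2" if "t \<le> z" "z < ?t" for z
  proof -
    have "z = t + (z - t)" "z - t < num_len (Suc j)"
      using that digit_pos_less[OF i] by simp_all
    with starts_code[OF st] num_code_less[of "z - t" "Suc j" a] show ?thesis
      by (metis add_2_eq_Suc' mult_Suc_right add.commute)
  qed
  \<comment> \<open>The only candidate is \<open>t - 1\<close>: codes from \<open>t\<close> on are
    too small, and the code at \<open>t - 1\<close> blocks every position further left.\<close>
  have s_iff: "(s < ?t \<and> 2 * j + 2 \<le> c s \<and> c s < 2 * j + 4 \<and> (\<forall>z. s < z \<and> z < ?t \<longrightarrow> c z < 2 * j + 2))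
     \<longleftrightarrow> 0 < t \<and> s = t - 1 \<and> c s div 2 = Suc j" for s
  proof
    assume s: "s < ?t \<and> 2 * j + 2 \<le> c s \<and> c s < 2 * j + 4 \<and> (\<forall>z. s < z \<and> z < ?t \<longrightarrow> c z < 2 * j + 2)"
    then have "s < t" using small[of s] by (meson not_le)
    moreover have "\<not> s < t - 1"
    proof
      assume "s < t - 1"
      with s have "c (t - 1) < 2 * j + 2" by simp
      with st \<open>s < t\<close> show False by (simp add: starts_def)
    qed
    moreover have "c s div 2 = Suc j" using s by auto
    ultimately show "0 < t \<and> s = t - 1 \<and> c s div 2 = Suc j" by auto
  next
    assume s: "0 < t \<and> s = t - 1 \<and> c s div 2 = Suc j"
    then show "s < ?t \<and> 2 * j + 2 \<le> c s \<and> c s < 2 * j + 4 \<and> (\<forall>z. s < z \<and> z < ?t \<longrightarrow> c z < 2 * j + 2)"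
      using small by auto
  qed
  show ?thesis
  proof (cases "0 < t \<and> c (t - 1) div 2 = Suc j")
    \<comment> \<open>No digit of the same level precedes, so by the context the number is 0 and all
      its bits vanish.\<close>
    case False
    have "\<not> next_bit c j ?t"
    proof
      assume "next_bit c j ?t"
      then obtain s where "s < ?t" "2 * j + 2 \<le> c s" "c s < 2 * j + 4"
        "\<forall>z. s < z \<and> z < ?t \<longrightarrow> c z < 2 * j + 2"
        unfolding next_bit_def by auto
      with s_iff[of s] False show False by simp
    qed
    moreover have "a = 0" using ctx False unfolding in_context_def by (auto split: if_splits)
    ultimately show ?thesis by simp
  next
    case True
    then obtain b where b: "ends c (Suc j) b (t - 1)" "a = Suc b" "Suc b < tower (Suc j)"
      using ctx unfolding in_context_def by auto
    then obtain t0 where t0: "t - 1 = t0 + num_len (Suc j)" "starts c (Suc j) b t0"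
      by (auto simp: ends_def)
    have "next_bit c j ?t \<longleftrightarrow> (\<exists>p. digit_before c j p (t - 1) \<and> same_num c j p ?t \<and>
       (2 * j + 1 \<le> c p \<longleftrightarrow> (\<exists>u<p. digit_before c j u (t - 1) \<and> c u < 2 * j + 1)))"
      (is "_ \<longleftrightarrow> ?R (t - 1)")
    proof -
      let ?Q = "\<lambda>s. s < ?t \<and> 2 * j + 2 \<le> c s \<and> c s < 2 * j + 4 \<and> (\<forall>z. s < z \<and> z < ?t \<longrightarrow> c z < 2 * j + 2)"
      have "next_bit c j ?t \<longleftrightarrow> (\<exists>s. ?Q s \<and> ?R s)"
        unfolding next_bit_def by (simp only: conj_assoc)
      also have "\<dots> \<longleftrightarrow> ?R (t - 1)"
        unfolding s_iff using True by simp
      finally show ?thesis .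
    qed
    \<comment> \<open>The index comparison forces \<open>m = i\<close>, which leaves the increment
      rule for bit \<open>i\<close> of \<open>b\<close>.\<close>
    also have "\<dots> \<longleftrightarrow> (\<exists>m<tower j. m = i \<and>
       (bit b m \<longleftrightarrow> (\<exists>l<tower j. digit_pos j l < digit_pos j m \<and> \<not> bit b l)))"
    proof -
      have same: "same_num c j (t0 + digit_pos j m) ?t \<longleftrightarrow> m = i" if "m < tower j" for m
        using same_num_iff[OF ends_digit[OF t0(2) that] ends_digit[OF st i] that i] .
      have ones: "2 * j + 1 \<le> c (t0 + digit_pos j m) \<longleftrightarrow> bit b m"
        "c (t0 + digit_pos j m) < 2 * j + 1 \<longleftrightarrow> \<not> bit b m" if "m < tower j" for m
        using starts_digit[OF t0(2) that] by simp_all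
      have dig: "digit_before c j p (t - 1) \<longleftrightarrow> (\<exists>m<tower j. p = t0 + digit_pos j m)" for p
        unfolding t0(1) by (rule digit_before_iff[OF t0(2)])
      have carry: "(\<exists>u<t0 + digit_pos j m. digit_before c j u (t - 1) \<and> c u < 2 * j + 1) \<longleftrightarrow>
          (\<exists>l<tower j. digit_pos j l < digit_pos j m \<and> \<not> bit b l)" for m
        unfolding dig using ones(2) by (metis nat_add_left_cancel_less)
      show ?thesis
      proof
        assume "\<exists>p. digit_before c j p (t - 1) \<and> same_num c j p ?t \<and>
          (2 * j + 1 \<le> c p \<longleftrightarrow> (\<exists>u<p. digit_before c j u (t - 1) \<and> c u < 2 * j + 1))"
        then obtain m where "m < tower j" "same_num c j (t0 + digit_pos j m) ?t"
          "2 * j + 1 \<le> c (t0 + digit_pos j m) \<longleftrightarrow>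
            (\<exists>u<t0 + digit_pos j m. digit_before c j u (t - 1) \<and> c u < 2 * j + 1)"
          using dig by (elim exE conjE) metis
        then show "\<exists>m<tower j. m = i \<and>
            (bit b m \<longleftrightarrow> (\<exists>l<tower j. digit_pos j l < digit_pos j m \<and> \<not> bit b l))"
          unfolding carry by (intro exI[of _ m]) (simp only: same ones(1))
      next
        assume "\<exists>m<tower j. m = i \<and>
            (bit b m \<longleftrightarrow> (\<exists>l<tower j. digit_pos j l < digit_pos j m \<and> \<not> bit b l))"
        then have "2 * j + 1 \<le> c (t0 + digit_pos j i) \<longleftrightarrow>
            (\<exists>u<t0 + digit_pos j i. digit_before c j u (t - 1) \<and> c u < 2 * j + 1)"
          using ones(1)[OF i] unfolding carry by simp
        then show "\<exists>p. digit_before c j p (t - 1) \<and> same_num c j p ?t \<and>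
          (2 * j + 1 \<le> c p \<longleftrightarrow> (\<exists>u<p. digit_before c j u (t - 1) \<and> c u < 2 * j + 1))"
          using same[OF i] dig[of "t0 + digit_pos j i"] i by (intro exI[of _ "t0 + digit_pos j i"]) auto
      qed
    qed
    also have "\<dots> \<longleftrightarrow> (bit b i \<longleftrightarrow> (\<exists>l<i. \<not> bit b l))"
    proof -
      have "digit_pos j l < digit_pos j i \<longleftrightarrow> l < i" for l
        unfolding digit_pos_def by (simp del: mult_Suc_right)
      then show ?thesis using i by (auto intro: less_trans)
    qed
    also have "\<dots> \<longleftrightarrow> bit a i" by (simp add: bit_Suc_nat b(2))
    finally show ?thesis .
  qed
qed

lemma code_ok_in_context:
  "in_context c j a t \<Longrightarrow> p < num_len j \<Longrightarrow> code_ok c (t + p)"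
proof (induction j arbitrary: a t p)
  case (Suc j)
  from Suc.prems(1) have st: "starts c (Suc j) a t" by (simp add: in_context_def)
  from Suc.prems(2) show ?case
  proof (cases rule: num_pos_cases)
    case (1 i)
    have c: "c (t + p) = 2 * j + of_bool (bit a i)" using starts_digit[OF st] 1 by simp
    have p: "t + p = t + i * Suc (num_len j) + num_len j" using 1 by (simp add: digit_pos_def)
    have "level_done c j' (t + p) \<longleftrightarrow> j = Suc j'" for j'
      unfolding p by (rule level_done_digit[OF in_context_sub[OF Suc.prems(1) 1(1)]])
    moreover have "next_bit c j (t + p) \<longleftrightarrow> bit a i"
      using next_bit_digit[OF Suc.prems(1)] 1 by simp
    ultimately show ?thesis using c by (simp add: code_ok_def)
  next
    case (2 i q)
    from Suc.IH[OF in_context_sub[OF Suc.prems(1) 2(1)] 2(2)] 2(3) show ?thesis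
      by (simp add: add.assoc)
  qed
qed simp

lemma starts_whole: "starts (num_code j a) j a 0"
  by (simp add: starts_def)

lemma code_ok_whole:
  "t < num_len j \<Longrightarrow> code_ok (num_code j 0) t"
  using code_ok_in_context[of "num_code j 0" j 0 0 t] starts_whole tower_pos
  by (simp add: in_context_def)

text \<open>In the number 0 of level \<open>k + 1\<close> every digit has code \<open>2 * k\<close>;
  the one with an all-ones index is the last.\<close>

lemma halts_iff:
  assumes "t < num_len (Suc k)"
  defines "c \<equiv> num_code (Suc k) 0"
  shows "2 * k \<le> c t \<and> all_ones c k t \<longleftrightarrow> Suc t = num_len (Suc k)"
proof -
  have st: "starts c (Suc k) 0 0" unfolding c_def by (rule starts_whole)
  from assms(1) show ?thesis
  proof (cases rule: num_pos_cases)
    case (1 i)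
    have "c t = 2 * k" using starts_digit[OF st] 1 by simp
    moreover have "all_ones c k t \<longleftrightarrow> Suc i = tower k"
      using all_ones_iff[OF ends_digit[OF st 1(1)] 1(1)] 1(2) by simp
    moreover have "Suc t = Suc i * Suc (num_len k)" using 1 by (simp add: digit_pos_def)
    then have "Suc t = num_len (Suc k) \<longleftrightarrow> Suc i = tower k"
      by (simp del: mult_Suc mult_Suc_right)
    ultimately show ?thesis by simp
  next
    case (2 i q)
    have "c t < 2 * k"
      using num_code_inner[of q k 0 i] num_code_less[of q k i] 2 by (simp add: c_def)
    moreover have "Suc t \<noteq> num_len (Suc k)"
    proof
      \<comment> \<open>Then \<open>Suc t\<close> is a multiple of \<open>Suc (num_len k)\<close>,
        but its remainder is \<open>Suc q\<close>, which is positive and at most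
        \<open>num_len k\<close>.\<close>
      assume "Suc t = num_len (Suc k)"
      then have "Suc (i * Suc (num_len k) + q) mod Suc (num_len k) = tower k * Suc (num_len k) mod Suc (num_len k)"
        using 2 by (simp only: num_len.simps)
      also have "\<dots> = 0" by (rule mod_mult_self2_is_0)
      finally have "Suc q mod Suc (num_len k) = 0"
        by (metis add.commute add_Suc mod_mult_self1)
      then show False using 2 by simp
    qed
    ultimately show ?thesis by simp
  qed
qed

text \<open>
  The code \<open>m\<close> is spelled as \<open>m\<close> letters \<open>l\<close> followed by one \<open>r\<close>; positions carrying \<open>r\<close> thus
  represent the entries of a code sequence.
\<close>

primrec block_start :: "(nat \<Rightarrow> nat) \<Rightarrow> nat \<Rightarrow> nat" where
  "block_start c 0 = 0"
| "block_start c (Suc t) = block_start c t + Suc (c t)"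

definition r_pos :: "(nat \<Rightarrow> nat) \<Rightarrow> nat \<Rightarrow> nat" where
  "r_pos c t = block_start c t + c t"

definition block_of :: "(nat \<Rightarrow> nat) \<Rightarrow> nat \<Rightarrow> nat" where
  "block_of c x = (LEAST t. x \<le> r_pos c t)"

definition code_word :: "(nat \<Rightarrow> nat) \<Rightarrow> nat \<Rightarrow> letter list" where
  "code_word c n = map (\<lambda>x. if x \<in> range (r_pos c) then Let_r else Let_l) [0..<block_start c n]"

section \<open>Converting between positions and block numbers\<close>

lemma block_start_ge: "t \<le> block_start c t"
  by (induction t) auto

lemma block_start_Suc_eq: "block_start c (Suc t) = Suc (r_pos c t)"
  by (simp add: r_pos_def)

lemma strict_mono_r_pos: "strict_mono (r_pos c)"
  unfolding strict_mono_Suc_iff r_pos_def by simp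

lemma r_pos_eq_iff [simp]: "r_pos c t = r_pos c t' \<longleftrightarrow> t = t'"
  using strict_mono_r_pos by (simp add: strict_mono_eq)

lemma r_pos_le_iff: "r_pos c t \<le> r_pos c t' \<longleftrightarrow> t \<le> t'"
  using strict_mono_r_pos by (simp add: strict_mono_less_eq)

lemma block_of_bound: "x \<le> r_pos c (block_of c x)"
  unfolding block_of_def
  by (rule LeastI[of _ x]) (use block_start_ge[of x c] in \<open>simp add: r_pos_def\<close>)

lemma block_of_r_pos [simp]: "block_of c (r_pos c t) = t"
  unfolding block_of_def by (rule Least_equality) (simp_all add: r_pos_le_iff)

text \<open>A Galois connection; as a simp rule it turns comparisons of positions into comparisons
  of block numbers.\<close>

lemma r_pos_less_iff [simp]: "r_pos c t < x \<longleftrightarrow> t < block_of c x"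
proof
  assume "r_pos c t < x"
  then have "r_pos c t < r_pos c (block_of c x)" using block_of_bound by (rule less_le_trans)
  then show "t < block_of c x" using strict_mono_r_pos by (simp add: strict_mono_less)
next
  assume "t < block_of c x"
  then show "r_pos c t < x" unfolding block_of_def by (meson not_less_Least not_le)
qed

text \<open>The left side is the simp normal form of
  \<open>r_pos c t < block_start c n\<close>.\<close>

lemma r_pos_in_word [simp]: "t < block_of c (block_start c n) \<longleftrightarrow> t < n"
proof (cases n)
  case (Suc m)
  have "t < block_of c (block_start c n) \<longleftrightarrow> r_pos c t < block_start c n" by simp
  also have "\<dots> \<longleftrightarrow> r_pos c t \<le> r_pos c m"
    unfolding Suc block_start_Suc_eq by (rule less_Suc_eq_le)
  also have "\<dots> \<longleftrightarrow> t < n" using Suc by (simp add: r_pos_le_iff less_Suc_eq_le)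
  finally show ?thesis .
qed (simp flip: r_pos_less_iff)

lemma block_of_less: "x < block_start c n \<Longrightarrow> block_of c x < n"
  by (cases n) (simp_all add: block_start_Suc_eq less_Suc_eq_le block_of_def Least_le
      del: block_start.simps(2))

lemma block_start_block_of: "block_start c (block_of c x) \<le> x"
proof (cases "block_of c x")
  case (Suc t)
  then have "r_pos c t < x" by simp
  with Suc show ?thesis by (simp add: block_start_Suc_eq del: block_start.simps(2) r_pos_less_iff)
qed simp

lemma length_code_word [simp]: "length (code_word c n) = block_start c n"
  by (simp add: code_word_def)

lemma nth_code_word:
  "x < block_start c n \<Longrightarrow> code_word c n ! x = Let_r \<longleftrightarrow> x = r_pos c (block_of c x)"
  by (auto simp: code_word_def)

section \<open>The formulas and their meaning on code words\<close>

text \<open>Bounding each quantifier by an earlier variable keeps the truth of a formula at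
  \<open>x\<close> independent of everything to the right of \<open>x\<close>.\<close>

definition bex :: "nat \<Rightarrow> nat \<Rightarrow> fo \<Rightarrow> fo" where
  "bex y x \<phi> = Ex y (Conj (Less y x) \<phi>)"

definition Imp :: "fo \<Rightarrow> fo \<Rightarrow> fo" where
  "Imp \<phi> \<psi> = Disj (Neg \<phi>) \<psi>"

definition Iff :: "fo \<Rightarrow> fo \<Rightarrow> fo" where
  "Iff \<phi> \<psi> = Disj (Conj \<phi> \<psi>) (Conj (Neg \<phi>) (Neg \<psi>))"

text \<open>A chain of immediate predecessors. Each step has constant size, so a unary code of
  length \<open>m\<close> costs linear size. \<open>Eq x x\<close> stands for truth.\<close>

primrec l_run :: "nat \<Rightarrow> nat \<Rightarrow> fo" where
  "l_run 0 x = Eq x x"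
| "l_run (Suc m) x = bex (x + 1) x (Conj (Neg (bex (x + 2) x (Less (x + 1) (x + 2))))
     (Conj (Pred Let_l (x + 1)) (l_run m (x + 1))))"

definition code_ge :: "nat \<Rightarrow> nat \<Rightarrow> fo" where
  "code_ge m x = Conj (Pred Let_r x) (l_run m x)"

text \<open>The name \<open>u + x + 1\<close> exceeds both \<open>u\<close> and \<open>x\<close>, so
  neither is captured.\<close>

definition digit_fo :: "nat \<Rightarrow> nat \<Rightarrow> nat \<Rightarrow> fo" where
  "digit_fo j u x = Conj (code_ge (2 * j) u) (Neg (bex (u + x + 1) x
     (Conj (code_ge (2 * j + 2) (u + x + 1)) (Neg (Less (u + x + 1) u)))))"

text \<open>
  Every index occurs in both numbers, so a single inclusion suffices for equality; as there is only
  one recursive call, the size is polynomial in \<open>j\<close>.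
\<close>

primrec same_num_fo :: "nat \<Rightarrow> nat \<Rightarrow> nat \<Rightarrow> fo" where
  "same_num_fo 0 x y = Eq x x"
| "same_num_fo (Suc j) x y = Neg (bex (x + y + 1) x (Conj (digit_fo j (x + y + 1) x)
     (Neg (bex (x + y + 2) y (Conj (digit_fo j (x + y + 2) y)
       (Conj (same_num_fo j (x + y + 1) (x + y + 2))
         (Iff (code_ge (2 * j + 1) (x + y + 1)) (code_ge (2 * j + 1) (x + y + 2)))))))))"

primrec all_ones_fo :: "nat \<Rightarrow> nat \<Rightarrow> fo" where
  "all_ones_fo 0 x = Eq x x"
| "all_ones_fo (Suc j) x = Neg (bex (x + 1) x (Conj (digit_fo j (x + 1) x)
     (Neg (code_ge (2 * j + 1) (x + 1)))))"

definition level_done_fo :: "nat \<Rightarrow> nat \<Rightarrow> fo" where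
  "level_done_fo j x = bex (x + 1) x (Conj (Conj (code_ge (2 * j) (x + 1)) (Neg (code_ge (2 * j + 2) (x + 1))))
     (Conj (Neg (bex (x + 2) x (Conj (Pred Let_r (x + 2)) (Less (x + 1) (x + 2)))))
       (all_ones_fo j (x + 1))))"

definition next_bit_fo :: "nat \<Rightarrow> nat \<Rightarrow> fo" where
  "next_bit_fo j x = bex (x + 1) x
     (Conj (Conj (code_ge (2 * j + 2) (x + 1)) (Neg (code_ge (2 * j + 4) (x + 1))))
     (Conj (Neg (bex (x + 2) x (Conj (code_ge (2 * j + 2) (x + 2)) (Less (x + 1) (x + 2)))))
       (bex (x + 3) (x + 1) (Conj (digit_fo j (x + 3) (x + 1)) (Conj (same_num_fo j (x + 3) x)
         (Iff (code_ge (2 * j + 1) (x + 3))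
           (bex (x + 4) (x + 3) (Conj (digit_fo j (x + 4) (x + 1))
             (Neg (code_ge (2 * j + 1) (x + 4)))))))))))"

text \<open>
  Inside a block whose code is \<open>m\<close>, the formula says that at least \<open>m\<close> letters \<open>l\<close> precede \<open>x\<close> in the
  block. The first clause needs no guard for level 0: at higher levels it is implied by the others.
\<close>

primrec rule_fo :: "nat \<Rightarrow> nat \<Rightarrow> fo" where
  "rule_fo 0 x = Imp (next_bit_fo 0 x) (l_run 1 x)"
| "rule_fo (Suc j) x = Conj (rule_fo j x) (Imp (level_done_fo j x)
     (Conj (l_run (2 * j + 2) x) (Imp (next_bit_fo (Suc j) x) (l_run (2 * j + 3) x))))"

definition halt_fo :: "nat \<Rightarrow> nat \<Rightarrow> fo" where
  "halt_fo k x = Conj (code_ge (2 * k) x) (all_ones_fo k x)"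

definition counter_fo :: "nat \<Rightarrow> fo" where
  "counter_fo k = Conj (All 0 (Iff (Pred Let_r 0) (rule_fo k 0)))
     (All 0 (Iff (Ex 1 (Less 0 1)) (Neg (halt_fo k 0))))"

section \<open>Evaluation of the formulas on code words\<close>

lemma sat_bex:
  assumes "y \<noteq> x" "s x \<le> length w"
  shows "sat w s (bex y x \<phi>) \<longleftrightarrow> (\<exists>i<s x. sat w (s(y := i)) \<phi>)"
  using assms by (auto simp: bex_def intro: less_le_trans)

lemma sat_Imp [simp]: "sat w s (Imp \<phi> \<psi>) \<longleftrightarrow> (sat w s \<phi> \<longrightarrow> sat w s \<psi>)"
  by (auto simp: Imp_def)

lemma sat_Iff [simp]: "sat w s (Iff \<phi> \<psi>) \<longleftrightarrow> (sat w s \<phi> \<longleftrightarrow> sat w s \<psi>)"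
  by (auto simp: Iff_def)

lemma sat_l_run:
  "s x < length w \<Longrightarrow>
    sat w s (l_run m x) \<longleftrightarrow> m \<le> s x \<and> (\<forall>i<m. w ! (s x - Suc i) = Let_l)"
proof (induction m arbitrary: s x)
  case (Suc m)
  have last: "(\<exists>i<s x. \<not> (\<exists>z<s x. i < z) \<and> P i) \<longleftrightarrow> 0 < s x \<and> P (s x - 1)" for P
  proof (cases "s x")
    case (Suc y)
    then have "i < s x \<and> \<not> (\<exists>z<s x. i < z) \<longleftrightarrow> i = y" for i
      by (auto simp: less_Suc_eq_le not_less)
    then show ?thesis using Suc by (metis diff_Suc_1 zero_less_Suc)
  qed simp
  have "sat w s (l_run (Suc m) x) \<longleftrightarrow> (\<exists>i<s x. \<not> (\<exists>z<s x. i < z) \<and> w ! i = Let_l \<and>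
      sat w (s(x + 1 := i)) (l_run m (x + 1)))"
    using Suc.prems by (simp add: sat_bex)
  also have "\<dots> \<longleftrightarrow> 0 < s x \<and> w ! (s x - 1) = Let_l \<and>
      sat w (s(x + 1 := s x - 1)) (l_run m (x + 1))"
    by (rule last)
  also have "\<dots> \<longleftrightarrow> 0 < s x \<and> w ! (s x - 1) = Let_l \<and> m \<le> s x - 1 \<and>
      (\<forall>k<m. w ! (s x - 1 - Suc k) = Let_l)"
    using Suc.prems by (subst Suc.IH) (simp_all add: less_imp_diff_less)
  also have "\<dots> \<longleftrightarrow> Suc m \<le> s x \<and> (\<forall>i<Suc m. w ! (s x - Suc i) = Let_l)"
    by (auto simp: less_Suc_eq_0_disj)
  finally show ?case .
qed simp

lemma sat_l_run_block:
  assumes "s x < block_start c n"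
  shows "sat (code_word c n) s (l_run m x) \<longleftrightarrow> m \<le> s x - block_start c (block_of c (s x))"
proof -
  let ?t = "block_of c (s x)"
  have len: "s x < length (code_word c n)" using assms by simp
  note sat = sat_l_run[where w = "code_word c n" and s = s and x = x, OF len]
  show ?thesis
  proof (cases "m \<le> s x - block_start c ?t")
    case True
    have "code_word c n ! (s x - Suc i) = Let_l" if "i < m" for i
    proof -
      have "s x - Suc i \<noteq> r_pos c t" for t
      proof
        assume *: "s x - Suc i = r_pos c t"
        with True that have "r_pos c t < s x" "\<not> r_pos c t < block_start c ?t" by linarith+
        then show False by simp
      qed
      with assms show ?thesis using nth_code_word[of "s x - Suc i" c n]
        by (metis letter.exhaust less_imp_diff_less)
    qed
    moreover have "m \<le> s x" using True by simp
    ultimately show ?thesis using True by (simp add: sat)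
  next
    case False
    show ?thesis
    proof (cases ?t)
      case 0
      with False show ?thesis by (simp add: sat)
    next
      case (Suc t')
      \<comment> \<open>The run before \<open>x\<close> inside its block has length
        \<open>d\<close>; one step further left stands the \<open>r\<close> closing the previous
        block.\<close>
      define d where "d = s x - block_start c ?t"
      have "s x - Suc d = r_pos c t'"
        using block_start_block_of[of c "s x"] Suc block_start_Suc_eq[of c t']
        by (simp add: d_def del: block_start.simps(2))
      moreover have "r_pos c t' < block_start c n" using block_of_less[OF assms] Suc by simp
      ultimately have "code_word c n ! (s x - Suc d) = Let_r"
        using nth_code_word[of "r_pos c t'" c n] by simp
      moreover have "d < m" using False d_def by simp
      ultimately show ?thesis using False by (force simp: sat)
    qed
  qed
qed

lemma sat_code_ge:
  assumes "s x < block_start c n"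
  shows "sat (code_word c n) s (code_ge m x) \<longleftrightarrow>
    s x = r_pos c (block_of c (s x)) \<and> m \<le> c (block_of c (s x))"
proof (cases "s x = r_pos c (block_of c (s x))")
  case True
  then have "s x - block_start c (block_of c (s x)) = c (block_of c (s x))"
    by (metis add_diff_cancel_left' r_pos_def)
  with True show ?thesis
    using nth_code_word[OF assms] sat_l_run_block[of s x c n m, OF assms] by (simp add: code_ge_def)
qed (use nth_code_word[OF assms] in \<open>simp add: code_ge_def\<close>)

text \<open>Such a formula confines \<open>y\<close> to positions carrying \<open>r\<close>, so
  quantifying over positions becomes quantifying over blocks.\<close>

definition r_only :: "nat \<Rightarrow> fo \<Rightarrow> bool" where
  "r_only y \<phi> \<longleftrightarrow> (\<forall>w s. sat w s \<phi> \<longrightarrow> w ! s y = Let_r)"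

lemma r_only_simps [simp]:
  "r_only y (Pred Let_r y)"
  "r_only y (code_ge m y)"
  "r_only y (digit_fo j y x)"
  "r_only y \<phi> \<Longrightarrow> r_only y (Conj \<phi> \<psi>)"
  by (simp_all add: r_only_def code_ge_def digit_fo_def)

lemma sat_bex_block:
  assumes "y \<noteq> x" "r_only y \<phi>" "s x < block_start c n"
  shows "sat (code_word c n) s (bex y x \<phi>) \<longleftrightarrow>
    (\<exists>t<block_of c (s x). sat (code_word c n) (s(y := r_pos c t)) \<phi>)"
proof -
  have "i = r_pos c (block_of c i)" if "i < s x" "sat (code_word c n) (s(y := i)) \<phi>" for i
  proof -
    have "code_word c n ! i = Let_r" using assms(2) that(2) unfolding r_only_def by fastforce
    then show ?thesis using nth_code_word[of i c n] that(1) assms(3) by simp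
  qed
  then have "(\<exists>i<s x. sat (code_word c n) (s(y := i)) \<phi>) \<longleftrightarrow>
    (\<exists>t<block_of c (s x). sat (code_word c n) (s(y := r_pos c t)) \<phi>)"
    by (metis r_pos_less_iff)
  then show ?thesis using assms by (simp add: sat_bex)
qed

declare l_run.simps [simp del]

lemma sat_digit_fo:
  assumes "u \<noteq> x" "s u < s x" "s x < block_start c n"
  shows "sat (code_word c n) s (digit_fo j u x) \<longleftrightarrow>
    s u = r_pos c (block_of c (s u)) \<and> digit_before c j (block_of c (s u)) (block_of c (s x))"
proof (cases "s u = r_pos c (block_of c (s u))")
  case True
  then obtain t' where t': "s u = r_pos c t'" by blast
  have t: "block_of c (s x) < n" using assms by (simp add: block_of_less)
  have lt: "t' < block_of c (s x)" using assms(2) t' by simp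
  have "sat (code_word c n) s (digit_fo j u x) \<longleftrightarrow> 2 * j \<le> c t' \<and>
      \<not> (\<exists>z<block_of c (s x). 2 * j + 2 \<le> c z \<and> \<not> z < t')"
    using assms t' t lt
    by (simp add: digit_fo_def sat_bex_block sat_code_ge cong: conj_cong)
  also have "\<dots> \<longleftrightarrow> digit_before c j t' (block_of c (s x))"
    unfolding digit_before_def using lt by (meson not_le)
  finally show ?thesis using t' by simp
next
  case False
  with assms show ?thesis by (simp add: digit_fo_def sat_code_ge)
qed

lemma digit_before_less: "digit_before c j u t \<Longrightarrow> u < t"
  by (simp add: digit_before_def)

lemma ex_digit_before:
  "(\<exists>u<t. digit_before c j u t \<and> P u) \<longleftrightarrow> (\<exists>u. digit_before c j u t \<and> P u)"
  using digit_before_less by blast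

lemma sat_same_num_fo:
  assumes "s x < block_start c n" "s y < block_start c n"
  shows "sat (code_word c n) s (same_num_fo j x y) \<longleftrightarrow>
    same_num c j (block_of c (s x)) (block_of c (s y))"
  using assms
proof (induction j arbitrary: s x y)
  case (Suc j)
  have t: "block_of c (s x) < n" "block_of c (s y) < n"
    using Suc.prems by (simp_all add: block_of_less)
  have "sat (code_word c n) s (same_num_fo (Suc j) x y) \<longleftrightarrow>
    \<not> (\<exists>u<block_of c (s x). digit_before c j u (block_of c (s x)) \<and>
      \<not> (\<exists>v<block_of c (s y). digit_before c j v (block_of c (s y)) \<and> same_num c j u v \<and>
        (2 * j + 1 \<le> c u \<longleftrightarrow> 2 * j + 1 \<le> c v)))"
    using Suc.prems t
    by (simp add: sat_bex_block sat_digit_fo sat_code_ge Suc.IH cong: conj_cong)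
  also have "\<dots> \<longleftrightarrow> same_num c (Suc j) (block_of c (s x)) (block_of c (s y))"
    unfolding ex_digit_before same_num.simps by blast
  finally show ?case .
qed simp

lemma sat_all_ones_fo:
  assumes "s x < block_start c n"
  shows "sat (code_word c n) s (all_ones_fo j x) \<longleftrightarrow> all_ones c j (block_of c (s x))"
proof (cases j)
  case (Suc i)
  have t: "block_of c (s x) < n" using assms by (simp add: block_of_less)
  have "sat (code_word c n) s (all_ones_fo j x) \<longleftrightarrow>
    \<not> (\<exists>u<block_of c (s x). digit_before c i u (block_of c (s x)) \<and> \<not> 2 * i + 1 \<le> c u)"
    using assms Suc t by (simp add: sat_bex_block sat_digit_fo sat_code_ge cong: conj_cong)
  then show ?thesis using Suc unfolding ex_digit_before by simp
qed simp

lemma sat_level_done_fo: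
  assumes "s x < block_start c n"
  shows "sat (code_word c n) s (level_done_fo j x) \<longleftrightarrow> level_done c j (block_of c (s x))"
proof -
  let ?t = "block_of c (s x)"
  have t: "?t < n" using assms by (simp add: block_of_less)
  have "sat (code_word c n) s (level_done_fo j x) \<longleftrightarrow> (\<exists>q<?t. (2 * j \<le> c q \<and> \<not> 2 * j + 2 \<le> c q) \<and>
     \<not> (\<exists>z<?t. q < z) \<and> all_ones c j q)"
    using assms t nth_code_word[of "r_pos c t'" c n for t']
    by (simp add: level_done_fo_def sat_bex_block sat_code_ge sat_all_ones_fo cong: conj_cong)
  also have "\<dots> \<longleftrightarrow> level_done c j ?t"
  proof (cases ?t)
    case (Suc t')
    have "q < ?t \<and> \<not> (\<exists>z<?t. q < z) \<longleftrightarrow> q = t'" for q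
      unfolding Suc by (auto simp: less_Suc_eq_le not_less)
    then show ?thesis unfolding level_done_def not_le by (metis Suc diff_Suc_1 zero_less_Suc)
  qed (simp add: level_done_def)
  finally show ?thesis .
qed

lemma sat_next_bit_fo:
  assumes "s x < block_start c n"
  shows "sat (code_word c n) s (next_bit_fo j x) \<longleftrightarrow> next_bit c j (block_of c (s x))"
proof -
  let ?t = "block_of c (s x)"
  have t: "?t < n" using assms by (simp add: block_of_less)
  have "sat (code_word c n) s (next_bit_fo j x) \<longleftrightarrow>
    (\<exists>q<?t. (2 * j + 2 \<le> c q \<and> \<not> 2 * j + 4 \<le> c q) \<and>
     \<not> (\<exists>z<?t. 2 * j + 2 \<le> c z \<and> q < z) \<and>
     (\<exists>p<q. digit_before c j p q \<and> same_num c j p ?t \<and>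
       (2 * j + 1 \<le> c p \<longleftrightarrow> (\<exists>u<p. digit_before c j u q \<and> \<not> 2 * j + 1 \<le> c u))))"
    using assms t
    by (simp add: next_bit_fo_def sat_bex_block sat_code_ge sat_digit_fo sat_same_num_fo
        cong: conj_cong)
  also have "\<dots> \<longleftrightarrow> next_bit c j ?t"
  proof -
    have "\<not> (\<exists>z<?t. 2 * j + 2 \<le> c z \<and> q < z) \<longleftrightarrow> (\<forall>z. q < z \<and> z < ?t \<longrightarrow> c z < 2 * j + 2)" for q
      by (meson not_le)
    then show ?thesis unfolding next_bit_def ex_digit_before not_le by (simp only: conj_assoc)
  qed
  finally show ?thesis .
qed

lemma sat_rule_fo:
  assumes "s x < block_start c n"
  defines "t \<equiv> block_of c (s x)"
  defines "d \<equiv> s x - block_start c t"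
  shows "sat (code_word c n) s (rule_fo k x) \<longleftrightarrow> (next_bit c 0 t \<longrightarrow> 1 \<le> d) \<and>
    (\<forall>j<k. level_done c j t \<longrightarrow> 2 * j + 2 \<le> d \<and> (next_bit c (Suc j) t \<longrightarrow> 2 * j + 3 \<le> d))"
  by (induction k)
    (use assms in \<open>auto simp: sat_next_bit_fo sat_level_done_fo sat_l_run_block less_Suc_eq\<close>)

text \<open>On a correct code the rule demands at least \<open>c t\<close> letters \<open>l\<close>
  earlier in the block. Since \<open>d\<close> never exceeds \<open>c t\<close>, this happens only
  at the end of the block, which is where \<open>r\<close> stands.\<close>

lemma sat_rule_fo_iff_letter:
  assumes x: "s x < block_start c n" and ok: "code_ok c (block_of c (s x))"
    and le: "c (block_of c (s x)) < 2 * Suc k"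
  shows "sat (code_word c n) s (rule_fo k x) \<longleftrightarrow> code_word c n ! s x = Let_r"
proof -
  define t where "t = block_of c (s x)"
  define d where "d = s x - block_start c t"
  have d: "s x = block_start c t + d" "d \<le> c t"
    using block_start_block_of[of c "s x"] block_of_bound[of "s x" c] by (auto simp: d_def t_def r_pos_def)
  have "sat (code_word c n) s (rule_fo k x) \<longleftrightarrow> (next_bit c 0 t \<longrightarrow> 1 \<le> d) \<and>
    (\<forall>j<k. level_done c j t \<longrightarrow> 2 * j + 2 \<le> d \<and> (next_bit c (Suc j) t \<longrightarrow> 2 * j + 3 \<le> d))"
    using sat_rule_fo[where s = s and x = x, OF x] by (simp add: t_def d_def)
  also have "\<dots> \<longleftrightarrow> c t \<le> d"
  \<comment> \<open>At level 0 no \<open>level_done\<close> clause fires; otherwise exactly the one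
    for \<open>j = c t div 2 - 1\<close> does, and it is among the first \<open>k\<close> by the
    bound on the code.\<close>
  proof (cases "c t div 2")
    case 0
    then have "c t = of_bool (odd (c t))" by (cases "c t = 0"; cases "c t = 1") auto
    moreover have "\<not> level_done c j t" for j using ok 0 by (simp add: code_ok_def t_def)
    moreover have "next_bit c 0 t \<longleftrightarrow> odd (c t)" using ok 0 by (simp add: code_ok_def t_def)
    ultimately show ?thesis by (cases "odd (c t)") auto
  next
    case (Suc j)
    have "c t = 2 * (c t div 2) + c t mod 2" by simp
    then have "c t = 2 * j + 2 + of_bool (odd (c t))"
      unfolding Suc by (simp add: odd_iff_mod_2_eq_one even_iff_mod_2_eq_zero)
    moreover have "level_done c i t \<longleftrightarrow> i = j" for i using ok Suc by (auto simp: code_ok_def t_def)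
    moreover have "next_bit c (Suc j) t \<longleftrightarrow> odd (c t)" using ok Suc by (simp add: code_ok_def t_def)
    moreover have "j < k" using le Suc by (simp add: t_def)
    ultimately show ?thesis by (cases "odd (c t)") auto
  qed
  also have "\<dots> \<longleftrightarrow> s x = r_pos c t" using d by (auto simp: r_pos_def)
  also have "\<dots> \<longleftrightarrow> code_word c n ! s x = Let_r" using nth_code_word[OF x] by (simp add: t_def)
  finally show ?thesis .
qed

section \<open>Existence and uniqueness of the model\<close>

definition counter_word :: "nat \<Rightarrow> letter list" where
  "counter_word k = code_word (num_code (Suc k) 0) (num_len (Suc k))"

lemma tower_le_length: "tower k \<le> length (counter_word k)"
proof -
  have "tower k \<le> num_len (Suc k)" by simp
  also have "\<dots> \<le> length (counter_word k)"
    unfolding counter_word_def length_code_word by (rule block_start_ge)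
  finally show ?thesis .
qed

lemma models_counter_fo:
  "models w (counter_fo k) \<longleftrightarrow>
     (\<forall>i<length w. (w ! i = Let_r \<longleftrightarrow> sat w ((\<lambda>_. 0)(0 := i)) (rule_fo k 0)) \<and>
       (Suc i < length w \<longleftrightarrow> \<not> sat w ((\<lambda>_. 0)(0 := i)) (halt_fo k 0)))"
proof -
  have "(\<exists>i'<length w. i < i') \<longleftrightarrow> Suc i < length w" for i
    by (auto intro: exI[of _ "Suc i"])
  then show ?thesis by (auto simp: models_def counter_fo_def)
qed

lemma counter_word_models: "models (counter_word k) (counter_fo k)"
  unfolding models_counter_fo
proof (intro allI impI conjI)
  define c n where "c = num_code (Suc k) 0" and "n = num_len (Suc k)"
  have word: "counter_word k = code_word c n" by (simp only: counter_word_def c_def n_def)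
  fix i assume "i < length (counter_word k)"
  then have i: "i < block_start c n" by (simp add: word)
  define t where "t = block_of c i"
  have t: "t < n" unfolding t_def by (rule block_of_less[OF i])
  have ok: "code_ok c t" "c t < 2 * Suc k"
    using code_ok_whole num_code_less t unfolding c_def n_def by blast+
  have halts: "2 * k \<le> c t \<and> all_ones c k t \<longleftrightarrow> Suc t = n"
    using halts_iff t unfolding c_def n_def by blast
  let ?s = "(\<lambda>_. 0)(0 := i) :: nat \<Rightarrow> nat"
  have s: "?s 0 < block_start c n" using i by simp
  have bt: "block_of c (?s 0) = t" by (simp add: t_def)
  show "counter_word k ! i = Let_r \<longleftrightarrow> sat (counter_word k) ?s (rule_fo k 0)"
    unfolding word using sat_rule_fo_iff_letter[where s = ?s and x = 0, OF s] ok unfolding bt by simp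
  have n: "n = Suc (n - 1)" using t by linarith
  have last: "block_start c n = Suc (r_pos c (n - 1))"
    using block_start_Suc_eq[of c "n - 1"] n by metis
  have "sat (code_word c n) ?s (halt_fo k 0) \<longleftrightarrow> i = r_pos c t \<and> 2 * k \<le> c t \<and> all_ones c k t"
    using sat_code_ge[where s = ?s and x = 0, OF s] sat_all_ones_fo[where s = ?s and x = 0, OF s]
    unfolding halt_fo_def bt by auto
  also have "\<dots> \<longleftrightarrow> i = r_pos c t \<and> Suc t = n" using halts by blast
  also have "\<dots> \<longleftrightarrow> Suc i = block_start c n"
  proof
    assume "i = r_pos c t \<and> Suc t = n"
    then show "Suc i = block_start c n" using block_start_Suc_eq[of c t] by metis
  next
    assume "Suc i = block_start c n"
    then have "i = r_pos c (n - 1)" using last by simp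
    then have "t = n - 1" by (simp only: t_def block_of_r_pos)
    then show "i = r_pos c t \<and> Suc t = n" using \<open>i = r_pos c (n - 1)\<close> n by simp
  qed
  finally show "Suc i < length (counter_word k) \<longleftrightarrow> \<not> sat (counter_word k) ?s (halt_fo k 0)"
    using i by (auto simp: word)
qed

text \<open>
  The variables in \<open>R\<close> bound the part of the word that may be inspected strictly below them; those
  in \<open>S\<close> may in addition be inspected themselves.
\<close>

definition prefix_local :: "nat set \<Rightarrow> nat set \<Rightarrow> fo \<Rightarrow> bool" where
  "prefix_local R S \<phi> \<longleftrightarrow> (\<forall>u w s.
     (\<forall>x\<in>R. s x < length u \<and> s x < length w \<and> (\<forall>i<s x. u ! i = w ! i)) \<and>
     (\<forall>x\<in>S. u ! s x = w ! s x) \<longrightarrow> sat u s \<phi> = sat w s \<phi>)"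

lemma prefix_localD:
  assumes "prefix_local R S \<phi>"
    and "\<And>x. x \<in> R \<Longrightarrow> s x < length u \<and> s x < length w \<and> (\<forall>i<s x. u ! i = w ! i)"
    and "\<And>x. x \<in> S \<Longrightarrow> u ! s x = w ! s x"
  shows "sat u s \<phi> = sat w s \<phi>"
  using assms unfolding prefix_local_def by blast

lemma prefix_local_simps [simp]:
  "prefix_local R S (Eq x y)"
  "prefix_local R S (Less x y)"
  "x \<in> S \<Longrightarrow> prefix_local R S (Pred a x)"
  "prefix_local R S \<phi> \<Longrightarrow> prefix_local R S (Neg \<phi>)"
  "prefix_local R S \<phi> \<Longrightarrow> prefix_local R S \<psi> \<Longrightarrow> prefix_local R S (Conj \<phi> \<psi>)"
  "prefix_local R S \<phi> \<Longrightarrow> prefix_local R S \<psi> \<Longrightarrow> prefix_local R S (Disj \<phi> \<psi>)"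
  unfolding prefix_local_def by (simp_all, blast+)

text \<open>A witness for \<open>y\<close> lies below \<open>x\<close>, in the common prefix, so it
  may be inspected as well as used as a bound.\<close>

lemma prefix_local_bex [simp]:
  assumes "x \<in> R" "y \<noteq> x" "prefix_local (insert y R) (insert y S) \<phi>"
  shows "prefix_local R S (bex y x \<phi>)"
  unfolding prefix_local_def
proof (intro allI impI)
  fix u w :: "letter list" and s
  assume *: "(\<forall>x\<in>R. s x < length u \<and> s x < length w \<and> (\<forall>i<s x. u ! i = w ! i)) \<and>
     (\<forall>x\<in>S. u ! s x = w ! s x)"
  then have x: "s x < length u" "s x < length w" "\<forall>i<s x. u ! i = w ! i" using assms(1) by auto
  have "sat u (s(y := i)) \<phi> = sat w (s(y := i)) \<phi>" if "i < s x" for i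
    by (rule prefix_localD[OF assms(3)]) (use * x that in auto)
  then have "(\<exists>i<s x. sat u (s(y := i)) \<phi>) \<longleftrightarrow> (\<exists>i<s x. sat w (s(y := i)) \<phi>)" by blast
  then show "sat u s (bex y x \<phi>) = sat w s (bex y x \<phi>)"
    using x by (simp add: sat_bex[OF assms(2)])
qed

lemma prefix_local_Imp_Iff [simp]:
  "prefix_local R S \<phi> \<Longrightarrow> prefix_local R S \<psi> \<Longrightarrow> prefix_local R S (Imp \<phi> \<psi>)"
  "prefix_local R S \<phi> \<Longrightarrow> prefix_local R S \<psi> \<Longrightarrow> prefix_local R S (Iff \<phi> \<psi>)"
  by (simp_all add: Imp_def Iff_def)

lemma prefix_local_l_run [simp]: "x \<in> R \<Longrightarrow> prefix_local R S (l_run m x)"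
  by (induction m arbitrary: x R S) (simp_all add: l_run.simps)

lemma prefix_local_code_ge [simp]: "x \<in> R \<Longrightarrow> x \<in> S \<Longrightarrow> prefix_local R S (code_ge m x)"
  by (simp add: code_ge_def)

lemma prefix_local_digit_fo [simp]:
  "u \<in> R \<Longrightarrow> u \<in> S \<Longrightarrow> x \<in> R \<Longrightarrow> prefix_local R S (digit_fo j u x)"
  by (simp add: digit_fo_def)

lemma prefix_local_same_num_fo [simp]:
  "x \<in> R \<Longrightarrow> y \<in> R \<Longrightarrow> prefix_local R S (same_num_fo j x y)"
  by (induction j arbitrary: x y R S) simp_all

lemma prefix_local_all_ones_fo [simp]: "x \<in> R \<Longrightarrow> prefix_local R S (all_ones_fo j x)"
  by (cases j) simp_all

text \<open>Here \<open>x\<close> may be absent from \<open>S\<close>: the rule does not look at the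
  letter it prescribes.\<close>

lemma prefix_local_rule_fo: "x \<in> R \<Longrightarrow> prefix_local R S (rule_fo k x)"
  by (induction k) (simp_all add: level_done_fo_def next_bit_fo_def)

lemma prefix_local_halt_fo: "x \<in> R \<Longrightarrow> x \<in> S \<Longrightarrow> prefix_local R S (halt_fo k x)"
  by (simp add: halt_fo_def)

lemma counter_fo_unique:
  assumes u: "models u (counter_fo k)" "u \<noteq> []" and w: "models w (counter_fo k)" "w \<noteq> []"
  shows "u = w"
proof -
  let ?s = "\<lambda>i. (\<lambda>_. 0)(0 := i) :: nat \<Rightarrow> nat"
  have common: "u ! i = w ! i" if "i < length u" "i < length w" for i
    using that
  proof (induction i rule: less_induct)
    case (less i)
    \<comment> \<open>The second set is empty because agreement at \<open>i\<close> itself is still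
      to be shown.\<close>
    have "sat u (?s i) (rule_fo k 0) = sat w (?s i) (rule_fo k 0)"
      by (rule prefix_localD[OF prefix_local_rule_fo[of 0 "{0}" "{}"]]) (use less in auto)
    then have "u ! i = Let_r \<longleftrightarrow> w ! i = Let_r"
      using u(1) w(1) less.prems unfolding models_counter_fo by blast
    then show ?case by (metis letter.exhaust)
  qed
  have not_shorter: "\<not> length v < length v'"
    if v: "models v (counter_fo k)" "v \<noteq> []" and v': "models v' (counter_fo k)"
      and common: "\<And>i. i < length v \<Longrightarrow> i < length v' \<Longrightarrow> v ! i = v' ! i" for v v'
  proof
    assume len: "length v < length v'"
    define i where "i = length v - 1"
    have i: "Suc i = length v" using v(2) by (simp add: i_def)
    \<comment> \<open>At the last position of the shorter word both words agree on halting, yet only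
      one of them continues.\<close>
    have "sat v (?s i) (halt_fo k 0) = sat v' (?s i) (halt_fo k 0)"
      by (rule prefix_localD[OF prefix_local_halt_fo[of 0 "{0}" "{0}"]]) (use i len common in auto)
    then show False using v(1) v' i len unfolding models_counter_fo
      by (metis Suc_lessD lessI less_irrefl)
  qed
  have "length u = length w"
    using not_shorter[OF u w(1)] not_shorter[OF w u(1)] common by (metis linorder_neqE_nat)
  then show ?thesis using common by (simp add: nth_equalityI)
qed

lemma defines_counter_word: "defines_word (counter_fo k) (counter_word k)"
proof -
  have "0 < length (counter_word k)" using tower_le_length[of k] tower_pos[of k] by linarith
  then show ?thesis
    using counter_word_models counter_fo_unique by (auto simp: defines_word_def Words_def)
qed

section \<open>Size of the formulas\<close>

lemma fv_bex [simp]: "fv (bex y x \<phi>) = insert y (insert x (fv \<phi>)) - {y}"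
  by (auto simp: bex_def)

lemma fv_Imp_Iff [simp]: "fv (Imp \<phi> \<psi>) = fv \<phi> \<union> fv \<psi>" "fv (Iff \<phi> \<psi>) = fv \<phi> \<union> fv \<psi>"
  by (auto simp: Imp_def Iff_def)

lemma fv_l_run: "fv (l_run m x) = {x}"
  by (induction m arbitrary: x) (auto simp: l_run.simps)

lemma fv_code_ge: "fv (code_ge m x) = {x}"
  by (simp add: code_ge_def fv_l_run)

lemma fv_digit_fo: "fv (digit_fo j u x) = {u, x}"
  by (auto simp: digit_fo_def fv_code_ge)

lemma fv_same_num_fo: "fv (same_num_fo j x y) \<subseteq> {x, y}"
proof (induction j arbitrary: x y)
  case (Suc j)
  from Suc[of "x + y + 1" "x + y + 2"] show ?case
    by (auto simp: fv_digit_fo fv_code_ge)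
qed simp

lemma fv_all_ones_fo: "fv (all_ones_fo j x) = {x}"
  by (cases j) (auto simp: fv_digit_fo fv_code_ge)

lemma fv_rule_fo: "fv (rule_fo k x) \<subseteq> {x}"
proof -
  have "fv (next_bit_fo j x) \<subseteq> {x}" for j
    using fv_same_num_fo[of j "x + 3" x]
    by (auto simp: next_bit_fo_def fv_digit_fo fv_code_ge)
  moreover have "fv (level_done_fo j x) \<subseteq> {x}" for j
    by (auto simp: level_done_fo_def fv_all_ones_fo fv_code_ge)
  ultimately show ?thesis by (induction k) (auto simp: fv_l_run)
qed

lemma sentence_counter_fo: "sentence (counter_fo k)"
  using fv_rule_fo[of k 0]
  by (auto simp: sentence_def counter_fo_def halt_fo_def fv_code_ge fv_all_ones_fo)

lemma sz_bex [simp]: "sz (bex y x \<phi>) = sz \<phi> + 3"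
  by (simp add: bex_def)

lemma sz_Imp_Iff [simp]: "sz (Imp \<phi> \<psi>) = sz \<phi> + sz \<psi> + 2" "sz (Iff \<phi> \<psi>) = 2 * sz \<phi> + 2 * sz \<psi> + 5"
  by (simp_all add: Imp_def Iff_def)

lemma sz_l_run [simp]: "sz (l_run m x) = 11 * m + 1"
  by (induction m arbitrary: x) (simp_all add: l_run.simps)

lemma sz_code_ge [simp]: "sz (code_ge m x) = 11 * m + 3"
  by (simp add: code_ge_def)

lemma sz_digit_fo [simp]: "sz (digit_fo j u x) = 44 * j + 36"
  by (simp add: digit_fo_def)

lemma sz_same_num_fo: "sz (same_num_fo j x y) \<le> 200 * (j + 1)\<^sup>2"
proof (induction j arbitrary: x y)
  case (Suc j)
  from Suc[of "x + y + 1" "x + y + 2"] show ?case by (simp add: power2_eq_square)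
qed simp

lemma sz_all_ones_fo: "sz (all_ones_fo j x) \<le> 100 * (j + 1)"
  by (cases j) simp_all

lemma sz_next_bit_fo: "sz (next_bit_fo j x) \<le> 1000 * (j + 1)\<^sup>2"
  using sz_same_num_fo[of j "x + 3" x] by (simp add: next_bit_fo_def power2_eq_square)

lemma sz_level_done_fo: "sz (level_done_fo j x) \<le> 300 * (j + 1)"
  using sz_all_ones_fo[of j "x + 1"] by (simp add: level_done_fo_def)

lemma sz_rule_fo: "sz (rule_fo k x) \<le> 2000 * (k + 1) ^ 3"
proof (induction k)
  case 0
  then show ?case using sz_next_bit_fo[of 0 x] by simp
next
  case (Suc k)
  then show ?case using sz_next_bit_fo[of "Suc k" x] sz_level_done_fo[of k x]
    by (simp add: power2_eq_square power3_eq_cube algebra_simps)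
qed

lemma sz_counter_fo: "sz (counter_fo k) \<le> 5000 * (k + 1) ^ 3"
proof -
  have "k + 1 \<le> (k + 1) ^ 3" by (rule self_le_power) simp_all
  then show ?thesis
    using sz_rule_fo[of k 0] sz_all_ones_fo[of k 0] by (simp add: counter_fo_def halt_fo_def)
qed

section \<open>Finiteness of the set of definable words\<close>

primrec vars :: "fo \<Rightarrow> nat set" where
  "vars (Eq x y) = {x, y}"
| "vars (Less x y) = {x, y}"
| "vars (Pred a x) = {x}"
| "vars (Neg \<phi>) = vars \<phi>"
| "vars (Conj \<phi> \<psi>) = vars \<phi> \<union> vars \<psi>"
| "vars (Disj \<phi> \<psi>) = vars \<phi> \<union> vars \<psi>"
| "vars (Ex x \<phi>) = insert x (vars \<phi>)"
| "vars (All x \<phi>) = insert x (vars \<phi>)"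

primrec rename :: "(nat \<Rightarrow> nat) \<Rightarrow> fo \<Rightarrow> fo" where
  "rename f (Eq x y) = Eq (f x) (f y)"
| "rename f (Less x y) = Less (f x) (f y)"
| "rename f (Pred a x) = Pred a (f x)"
| "rename f (Neg \<phi>) = Neg (rename f \<phi>)"
| "rename f (Conj \<phi> \<psi>) = Conj (rename f \<phi>) (rename f \<psi>)"
| "rename f (Disj \<phi> \<psi>) = Disj (rename f \<phi>) (rename f \<psi>)"
| "rename f (Ex x \<phi>) = Ex (f x) (rename f \<phi>)"
| "rename f (All x \<phi>) = All (f x) (rename f \<phi>)"

lemma sat_rename:
  assumes "inj_on f V"
  shows "vars \<phi> \<subseteq> V \<Longrightarrow> (\<And>x. x \<in> V \<Longrightarrow> s' (f x) = s x) \<Longrightarrow> sat w s' (rename f \<phi>) = sat w s \<phi>"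
proof (induction \<phi> arbitrary: s s')
  case (Ex x \<phi>)
  have "sat w (s'(f x := i)) (rename f \<phi>) = sat w (s(x := i)) \<phi>" for i
    using Ex.prems assms by (intro Ex.IH) (auto simp: inj_on_eq_iff)
  then show ?case by simp
next
  case (All x \<phi>)
  have "sat w (s'(f x := i)) (rename f \<phi>) = sat w (s(x := i)) \<phi>" for i
    using All.prems assms by (intro All.IH) (auto simp: inj_on_eq_iff)
  then show ?case by simp
next
  case (Conj \<phi> \<psi>)
  from Conj.IH[of s' s] Conj.prems show ?case by simp
next
  case (Disj \<phi> \<psi>)
  from Disj.IH[of s' s] Disj.prems show ?case by simp
next
  case (Neg \<phi>)
  from Neg.IH[of s' s] Neg.prems show ?case by simp
qed simp_all

lemma sz_rename [simp]: "sz (rename f \<phi>) = sz \<phi>"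
  by (induction \<phi>) simp_all

lemma vars_rename [simp]: "vars (rename f \<phi>) = f ` vars \<phi>"
  by (induction \<phi>) auto

lemma finite_vars: "finite (vars \<phi>)"
  by (induction \<phi>) auto

lemma card_vars_le: "card (vars \<phi>) \<le> 2 * sz \<phi>"
proof (induction \<phi>)
  case (Conj \<phi> \<psi>)
  then show ?case using card_Un_le[of "vars \<phi>" "vars \<psi>"] by simp
next
  case (Disj \<phi> \<psi>)
  then show ?case using card_Un_le[of "vars \<phi>" "vars \<psi>"] by simp
qed (simp_all add: card_insert_if finite_vars)

lemma finite_fo_bounded: "finite {\<phi>. sz \<phi> \<le> n \<and> vars \<phi> \<subseteq> V}" if "finite V"
proof (induction n)
  case 0
  have "0 < sz \<phi>" for \<phi> by (cases \<phi>) auto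
  then have "{\<phi>. sz \<phi> \<le> 0 \<and> vars \<phi> \<subseteq> V} = {}" by (auto simp: not_le)
  then show ?case by (simp only: finite.emptyI)
next
  case (Suc n)
  let ?F = "{\<phi>. sz \<phi> \<le> n \<and> vars \<phi> \<subseteq> V}"
  have letters: "finite (UNIV :: letter set)"
    by (rule finite_subset[of _ "{Let_l, Let_r}"]) (use letter.exhaust in auto)
  have "{\<phi>. sz \<phi> \<le> Suc n \<and> vars \<phi> \<subseteq> V} \<subseteq>
    (\<lambda>(x, y). Eq x y) ` (V \<times> V) \<union> (\<lambda>(x, y). Less x y) ` (V \<times> V) \<union>
    (\<lambda>(a, x). Pred a x) ` (UNIV \<times> V) \<union> Neg ` ?F \<union> (\<lambda>(\<phi>, \<psi>). Conj \<phi> \<psi>) ` (?F \<times> ?F) \<union>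
    (\<lambda>(\<phi>, \<psi>). Disj \<phi> \<psi>) ` (?F \<times> ?F) \<union> (\<lambda>(x, \<phi>). Ex x \<phi>) ` (V \<times> ?F) \<union>
    (\<lambda>(x, \<phi>). All x \<phi>) ` (V \<times> ?F)" (is "_ \<subseteq> ?U")
  proof
    fix \<phi> assume "\<phi> \<in> {\<phi>. sz \<phi> \<le> Suc n \<and> vars \<phi> \<subseteq> V}"
    then show "\<phi> \<in> ?U" by (cases \<phi>) (force simp: image_iff)+
  qed
  moreover have "finite ?U" using that letters Suc by simp
  ultimately show ?case by (rule finite_subset)
qed

text \<open>\<open>DN\<close> is a \<open>Max\<close>, which bounds the members only of a finite
  set. A formula of size at most \<open>n\<close> has at most \<open>2 * n\<close> variables;
  renaming them injectively into a fixed finite set keeps the defined word, and only finitely many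
  formulas remain.\<close>

lemma finite_Def_FO: "finite (Def (FO n))"
proof -
  let ?F = "{\<phi>. sz \<phi> \<le> n \<and> vars \<phi> \<subseteq> {..<2 * n}}"
  have "Def (FO n) \<subseteq> (\<lambda>\<phi>. THE w. defines_word \<phi> w) ` ?F"
  proof
    fix w assume "w \<in> Def (FO n)"
    then obtain \<phi> where \<phi>: "sz \<phi> \<le> n" "defines_word \<phi> w" by (auto simp: Def_def FO_def)
    have "card (vars \<phi>) \<le> card {..<2 * n}" using card_vars_le[of \<phi>] \<phi>(1) by simp
    then obtain f where f: "f ` vars \<phi> \<subseteq> {..<2 * n}" "inj_on f (vars \<phi>)"
      using card_le_inj[OF finite_vars] by blast
    have "models u (rename f \<phi>) = models u \<phi>" for u
      unfolding models_def by (rule sat_rename[OF f(2)]) auto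
    then have "defines_word (rename f \<phi>) w" using \<phi>(2) by (simp add: defines_word_def)
    moreover from this have "(THE w. defines_word (rename f \<phi>) w) = w"
      by (intro the_equality) (auto simp: defines_word_def)
    moreover have "rename f \<phi> \<in> ?F" using \<phi>(1) f(1) by simp
    ultimately show "w \<in> (\<lambda>\<phi>. THE w. defines_word \<phi> w) ` ?F" by force
  qed
  then show ?thesis using finite_fo_bounded[of "{..<2 * n}" n] by (meson finite_imageI finite_lessThan finite_subset)
qed

section \<open>The lower bound\<close>

lemma tower_le_DN:
  assumes "5000 * (k + 1) ^ 3 \<le> n"
  shows "tower k \<le> DN (FO n)"
proof -
  have "counter_word k \<in> Def (FO n)"
    using defines_counter_word sentence_counter_fo order_trans[OF sz_counter_fo assms]
    by (auto simp: Def_def FO_def)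
  then have "length (counter_word k) \<le> DN (FO n)"
    unfolding DN_def by (intro Max_ge) (simp_all add: finite_Def_FO)
  with tower_le_length[of k] show ?thesis by linarith
qed

theorem theorem3:
  "\<exists>c::nat. c > 0 \<and> infinite {n::nat. DN (FO n) \<ge> twr (root 5 (real n / real c))}"
proof (intro exI conjI)
  \<comment> \<open>Fifth powers make the root an integer, so the ceiling is exact. The constant is
    \<open>8 * 5000\<close>, the factor 8 absorbing the passage from \<open>(Suc k + 1) ^ 3\<close>
    to \<open>Suc k ^ 3\<close>.\<close>
  let ?f = "\<lambda>k::nat. 40000 * Suc k ^ 5"
  have "?f k \<in> {n. DN (FO n) \<ge> twr (root 5 (real n / real (40000::nat)))}" for k
  proof -
    have "real (?f k) / real (40000::nat) = real (Suc k) ^ 5" by simp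
    then have "root 5 (real (?f k) / real (40000::nat)) = real (Suc k)"
      by (simp only: real_root_power_cancel zero_less_numeral of_nat_0_le_iff)
    then have "twr (root 5 (real (?f k) / real (40000::nat))) = tower (Suc k)"
      by (simp only: twr_def ceiling_of_nat nat_int)
    moreover have "tower (Suc k) \<le> DN (FO (?f k))"
    proof (rule tower_le_DN)
      have "(Suc k + 1) ^ 3 \<le> (2 * Suc k) ^ 3" by (rule power_mono) simp_all
      also have "\<dots> = 8 * Suc k ^ 3" by (simp only: power_mult_distrib) simp
      also have "\<dots> \<le> 8 * Suc k ^ 5" by (intro mult_le_mono2 power_increasing) simp_all
      finally show "5000 * (Suc k + 1) ^ 3 \<le> ?f k" by linarith
    qed
    ultimately show ?thesis by simp
  qed
  then have "range ?f \<subseteq> {n. DN (FO n) \<ge> twr (root 5 (real n / real (40000::nat)))}" by blast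
  moreover have "inj ?f" by (rule injI) (simp add: power_eq_iff_eq_base del: power_Suc)
  then have "infinite (range ?f)" using finite_imageD infinite_UNIV_nat by blast
  ultimately show "infinite {n. DN (FO n) \<ge> twr (root 5 (real n / real (40000::nat)))}"
    by (rule infinite_super)
qed simp

end
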